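(* Let $\varepsilon>0$. In the deterministic IPDS algorithm (described in the context), choose $\rho_0=8L_{\mathrm D}$ and, for every $k\in\mathbb Z_+$, $$\tau_k=\frac{k+1}{k+3},\qquad\gamma_k=\frac{\varepsilon}{4(k+3)},\qquad\eta_k=\frac{\varepsilon}{4(k+3)}.$$ Then for any starting point $(x^0,\lambda^0)\in\mathcal X\times\Lambda$ and any $K\in\mathbb N$, $$\Delta_{\rho_K}(x^K,\lambda^K)\le\frac{2\Delta_{\rho_0}(x^0,\lambda^0)}{(K+1)(K+2)}+\frac\varepsilon2.$$ Furthermore, if $\Lambda$ is bounded, then $$\Delta(x^K,\lambda^K)\le\frac{32L_{\mathrm D}B_{\omega,\Lambda}+2\Delta(x^0,\lambda^0)}{(K+1)(K+2)}+\frac\varepsilon2,$$ where $B_{\omega,\Lambda}:=\sup_{\lambda\in\Lambda}|\omega(\lambda)|$.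
   Context: Setting. $\mathbb E_1,\mathbb E_2$ are finite-dimensional real normed spaces (norms $\|\cdot\|$, dual norms $\|\cdot\|_*$, pairing $\langle\cdot,\cdot\rangle$). $\mathcal X\subseteq\mathbb E_1$, $\Lambda\subseteq\mathbb E_2$ are nonempty, closed, convex, $\mathcal X$ bounded. $f,g:\mathbb E_1\to\mathbb R\cup\{+\infty\}$, $h:\mathbb E_2\to\mathbb R\cup\{+\infty\}$ are convex, closed, proper, $\mathcal X\subseteq\mathrm{dom}\,g$, $\Lambda\subseteq\mathrm{dom}\,h$. $f$ is differentiable on an open set containing $\mathcal X$, and is $\mu$-strongly convex and $L$-smooth on $\mathcal X$: $\frac\mu2\|x-x'\|^2\le f(x)-f(x')-\langle\nabla f(x'),x-x'\rangle\le\frac L2\|x-x'\|^2$ for $x,x'\in\mathcal X$, with $L\ge\mu>0$. $\Phi:\mathbb E_1\times\mathbb E_2\to\mathbb R$ is convex in $x$, concave in $\lambda$, differentiable in each argument, and for all $x,x'\in\mathcal X$, $\lambda,\lambda'\in\Lambda$: $\|\nabla_x\Phi(x,\lambda)-\nabla_x\Phi(x',\lambda)\|_*\le L_{xx}\|x-x'\|$, $\|\nabla_x\Phi(x,\lambda)-\nabla_x\Phi(x,\lambda')\|_*\le L_{\lambda x}\|\lambda-\lambda'\|$, $\|\nabla_\lambda\Phi(x,\lambda)-\nabla_\lambda\Phi(x',\lambda)\|_*\le L_{\lambda x}\|x-x'\|$, $\|\nabla_\lambda\Phi(x,\lambda)-\nabla_\lambda\Phi(x,\lambda')\|_*\le L_{\lambda\lambda}\|\lambda-\lambda'\|$.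 The saddle point problem is $\min_{x\in\mathcal X}\max_{\lambda\in\Lambda}S(x,\lambda)$, $S(x,\lambda):=f(x)+g(x)+\Phi(x,\lambda)-h(\lambda)$, and a saddle point on $\mathcal X\times\Lambda$ is assumed to exist. $\omega:\mathbb E_2\to\mathbb R\cup\{+\infty\}$ is convex, closed, proper, $1$-strongly convex and continuous (finite) on $\Lambda$, and essentially smooth. $L_{\mathrm D}:=L_{\lambda\lambda}+L_{\lambda x}^2/\mu$ (the choice $\rho_0=8L_{\mathrm D}$ together with the requirement $\rho_0>0$ means $L_{\mathrm D}>0$). Definitions. $\widehat S^{\mathrm P}(x,\lambda):=f(x)+g(x)+\Phi(x,\lambda)$, $\widehat\psi^{\mathrm D}(\lambda):=\inf_{x\in\mathcal X}\widehat S^{\mathrm P}(x,\lambda)$, $\psi^{\mathrm D}(\lambda):=\widehat\psi^{\mathrm D}(\lambda)-h(\lambda)$, $\psi^{\mathrm P}(x):=\sup_{\lambda\in\Lambda}S(x,\lambda)$. For $\rho>0$: $\widehat S^{\mathrm D}_\rho(x,\lambda):=\Phi(x,\lambda)-h(\lambda)-\rho\,\omega(\lambda)$, $\widehat\psi^{\mathrm P}_\rho(x):=\sup_{\lambda\in\Lambda}\widehat S^{\mathrm D}_\rho(x,\lambda)$, $\psi^{\mathrm P}_\rho(x):=f(x)+g(x)+\widehat\psi^{\mathrm P}_\rho(x)$. Duality gap: $\Delta(x,\lambda):=\psi^{\mathrm P}(x)-\psi^{\mathrm D}(\lambda)$. Smoothed duality gap: $\Delta_\rho(x,\lambda):=\psi^{\mathrm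 P}_\rho(x)-\psi^{\mathrm D}(\lambda)$. Deterministic IPDS algorithm. Inputs: $\rho_0>0$, nonnegative sequences $\{\eta_k\},\{\gamma_k\}$, $\{\tau_k\}\subseteq(0,1)$ $(k\in\mathbb Z_+=\{0,1,\dots\})$, $x^0\in\mathcal X$, $\lambda^0\in\Lambda$. For $k=0,1,\dots$: (1) find $\widetilde\lambda_{\rho_k,\eta_k}(x^k)\in\Lambda$ with $\widehat\psi^{\mathrm P}_{\rho_k}(x^k)-\widehat S^{\mathrm D}_{\rho_k}(x^k,\widetilde\lambda_{\rho_k,\eta_k}(x^k))\le\eta_k$; (2) $\hat\lambda^k=\tau_k\lambda^k+(1-\tau_k)\widetilde\lambda_{\rho_k,\eta_k}(x^k)$; (3) find $\widetilde x_{\gamma_k}(\hat\lambda^k)\in\mathcal X$ with $\widehat S^{\mathrm P}(\widetilde x_{\gamma_k}(\hat\lambda^k),\hat\lambda^k)-\widehat\psi^{\mathrm D}(\hat\lambda^k)\le\gamma_k$; (4) $x^{k+1}=\tau_kx^k+(1-\tau_k)\widetilde x_{\gamma_k}(\hat\lambda^k)$; (5) $\rho_{k+1}=\tau_k\rho_k$; (6) find $\widetilde\lambda_{\rho_{k+1},\eta_k}(x^{k+1})\in\Lambda$ with $\widehat\psi^{\mathrm P}_{\rho_{k+1}}(x^{k+1})-\widehat S^{\mathrm D}_{\rho_{k+1}}(x^{k+1},\widetilde\lambda_{\rho_{k+1},\eta_k}(x^{k+1}))\le\eta_k$; (7) $\lambda^{k+1}=\tau_k\lambda^k+(1-\tau_k)\widetilde\lambda_{\rho_{k+1},\eta_k}(x^{k+1})$.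 *)

theory Defs
  imports "HOL-Analysis.Analysis"
begin

section \<open>Convex analysis of extended-real-valued functions\<close>

definition ext_dom :: "('a \<Rightarrow> ereal) \<Rightarrow> 'a set" where
  "ext_dom F = {x. F x < \<infinity>}"

definition ext_epi :: "('a \<Rightarrow> ereal) \<Rightarrow> ('a \<times> real) set" where
  "ext_epi F = {(x, r). F x \<le> ereal r}"

definition ext_proper :: "('a \<Rightarrow> ereal) \<Rightarrow> bool" where
  "ext_proper F \<longleftrightarrow> (\<forall>x. F x \<noteq> -\<infinity>) \<and> ext_dom F \<noteq> {}"

definition convex_closed_proper :: "('a::real_normed_vector \<Rightarrow> ereal) \<Rightarrow> bool" where
  "convex_closed_proper F \<longleftrightarrow> convex (ext_epi F) \<and> closed (ext_epi F) \<and> ext_proper F"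

text \<open>Strong convexity in the derivative-free form, since \<open>F\<close> need not be differentiable on all
  of \<open>C\<close> (for instance at points of \<open>C\<close> on the boundary of the domain of \<open>F\<close>).\<close>

definition ext_strongly_convex_on ::
  "real \<Rightarrow> 'a::real_normed_vector set \<Rightarrow> ('a \<Rightarrow> ereal) \<Rightarrow> bool" where
  "ext_strongly_convex_on m C F \<longleftrightarrow>
    (\<forall>x\<in>C. \<forall>y\<in>C. \<forall>t\<in>{0..1}.
       F ((1 - t) *\<^sub>R x + t *\<^sub>R y) + ereal (m / 2 * t * (1 - t) * (norm (x - y))\<^sup>2)
         \<le> ereal (1 - t) * F x + ereal t * F y)"

text \<open>Gradients are elements of the dual space \<open>'a \<Rightarrow>\<^sub>L real\<close>, whose norm is the dual norm of the
  given (not necessarily Euclidean) norm and whose application is the duality pairing.\<close>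

definition has_gradient ::
  "('a::real_normed_vector \<Rightarrow> real) \<Rightarrow> ('a \<Rightarrow>\<^sub>L real) \<Rightarrow> 'a \<Rightarrow> bool" where
  "has_gradient F d x \<longleftrightarrow> (F has_derivative blinfun_apply d) (at x)"

text \<open>Essential smoothness in the sense of Rockafellar.\<close>

definition essentially_smooth :: "('a::real_normed_vector \<Rightarrow> ereal) \<Rightarrow> bool" where
  "essentially_smooth F \<longleftrightarrow>
    interior (ext_dom F) \<noteq> {} \<and>
    (\<exists>F'. (\<forall>x\<in>interior (ext_dom F). has_gradient (\<lambda>y. real_of_ereal (F y)) (F' x) x) \<and>
       (\<forall>s z. (\<forall>n. s n \<in> interior (ext_dom F)) \<and> s \<longlonglongrightarrow> z \<and> z \<in> frontier (interior (ext_dom F))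
          \<longrightarrow> filterlim (\<lambda>n. norm (F' (s n))) at_top sequentially))"


section \<open>Saddle function, primal and dual functions, duality gaps\<close>

definition S_fun ::
  "('a \<Rightarrow> ereal) \<Rightarrow> ('a \<Rightarrow> ereal) \<Rightarrow> ('b \<Rightarrow> ereal) \<Rightarrow> ('a \<Rightarrow> 'b \<Rightarrow> real) \<Rightarrow> 'a \<Rightarrow> 'b \<Rightarrow> ereal" where
  "S_fun f g h \<Phi> x l = f x + g x + ereal (\<Phi> x l) - h l"

definition saddle_point :: "'a set \<Rightarrow> 'b set \<Rightarrow> ('a \<Rightarrow> 'b \<Rightarrow> ereal) \<Rightarrow> 'a \<Rightarrow> 'b \<Rightarrow> bool" where
  "saddle_point X \<Lambda> S xs ls \<longleftrightarrow>
    xs \<in> X \<and> ls \<in> \<Lambda> \<and> (\<forall>x\<in>X. \<forall>l\<in>\<Lambda>. S xs l \<le> S xs ls \<and> S xs ls \<le> S x ls)"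

definition SP_hat ::
  "('a \<Rightarrow> ereal) \<Rightarrow> ('a \<Rightarrow> ereal) \<Rightarrow> ('a \<Rightarrow> 'b \<Rightarrow> real) \<Rightarrow> 'a \<Rightarrow> 'b \<Rightarrow> ereal" where
  "SP_hat f g \<Phi> x l = f x + g x + ereal (\<Phi> x l)"

definition psiD_hat ::
  "'a set \<Rightarrow> ('a \<Rightarrow> ereal) \<Rightarrow> ('a \<Rightarrow> ereal) \<Rightarrow> ('a \<Rightarrow> 'b \<Rightarrow> real) \<Rightarrow> 'b \<Rightarrow> ereal" where
  "psiD_hat X f g \<Phi> l = (INF x\<in>X. SP_hat f g \<Phi> x l)"

definition psiD ::
  "'a set \<Rightarrow> ('a \<Rightarrow> ereal) \<Rightarrow> ('a \<Rightarrow> ereal) \<Rightarrow> ('b \<Rightarrow> ereal) \<Rightarrow> ('a \<Rightarrow> 'b \<Rightarrow> real) \<Rightarrow> 'b \<Rightarrow> ereal" where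
  "psiD X f g h \<Phi> l = psiD_hat X f g \<Phi> l - h l"

definition psiP ::
  "'b set \<Rightarrow> ('a \<Rightarrow> ereal) \<Rightarrow> ('a \<Rightarrow> ereal) \<Rightarrow> ('b \<Rightarrow> ereal) \<Rightarrow> ('a \<Rightarrow> 'b \<Rightarrow> real) \<Rightarrow> 'a \<Rightarrow> ereal" where
  "psiP \<Lambda> f g h \<Phi> x = (SUP l\<in>\<Lambda>. S_fun f g h \<Phi> x l)"

definition SD_hat ::
  "('b \<Rightarrow> ereal) \<Rightarrow> ('a \<Rightarrow> 'b \<Rightarrow> real) \<Rightarrow> ('b \<Rightarrow> ereal) \<Rightarrow> real \<Rightarrow> 'a \<Rightarrow> 'b \<Rightarrow> ereal" where
  "SD_hat h \<Phi> \<omega> \<rho> x l = ereal (\<Phi> x l) - h l - ereal \<rho> * \<omega> l"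

definition psiP_hat ::
  "'b set \<Rightarrow> ('b \<Rightarrow> ereal) \<Rightarrow> ('a \<Rightarrow> 'b \<Rightarrow> real) \<Rightarrow> ('b \<Rightarrow> ereal) \<Rightarrow> real \<Rightarrow> 'a \<Rightarrow> ereal" where
  "psiP_hat \<Lambda> h \<Phi> \<omega> \<rho> x = (SUP l\<in>\<Lambda>. SD_hat h \<Phi> \<omega> \<rho> x l)"

definition psiP_smoothed ::
  "'b set \<Rightarrow> ('a \<Rightarrow> ereal) \<Rightarrow> ('a \<Rightarrow> ereal) \<Rightarrow> ('b \<Rightarrow> ereal) \<Rightarrow> ('a \<Rightarrow> 'b \<Rightarrow> real) \<Rightarrow> ('b \<Rightarrow> ereal)
    \<Rightarrow> real \<Rightarrow> 'a \<Rightarrow> ereal" where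
  "psiP_smoothed \<Lambda> f g h \<Phi> \<omega> \<rho> x = f x + g x + psiP_hat \<Lambda> h \<Phi> \<omega> \<rho> x"

definition duality_gap ::
  "'a set \<Rightarrow> 'b set \<Rightarrow> ('a \<Rightarrow> ereal) \<Rightarrow> ('a \<Rightarrow> ereal) \<Rightarrow> ('b \<Rightarrow> ereal) \<Rightarrow> ('a \<Rightarrow> 'b \<Rightarrow> real)
    \<Rightarrow> 'a \<Rightarrow> 'b \<Rightarrow> ereal" where
  "duality_gap X \<Lambda> f g h \<Phi> x l = psiP \<Lambda> f g h \<Phi> x - psiD X f g h \<Phi> l"

definition smoothed_gap ::
  "'a set \<Rightarrow> 'b set \<Rightarrow> ('a \<Rightarrow> ereal) \<Rightarrow> ('a \<Rightarrow> ereal) \<Rightarrow> ('b \<Rightarrow> ereal) \<Rightarrow> ('a \<Rightarrow> 'b \<Rightarrow> real)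
    \<Rightarrow> ('b \<Rightarrow> ereal) \<Rightarrow> real \<Rightarrow> 'a \<Rightarrow> 'b \<Rightarrow> ereal" where
  "smoothed_gap X \<Lambda> f g h \<Phi> \<omega> \<rho> x l =
    psiP_smoothed \<Lambda> f g h \<Phi> \<omega> \<rho> x - psiD X f g h \<Phi> l"


section \<open>Standing assumptions\<close>

text \<open>The functions \<open>f'\<close>, \<open>\<Phi>x\<close>, \<open>\<Phi>l\<close> are the gradient of \<open>f\<close> and the partial gradients of \<open>\<Phi>\<close>;
  they are uniquely determined wherever the assumptions below use them.\<close>

locale saddle_problem =
  fixes X :: "'a::real_normed_vector set" and \<Lambda> :: "'b::real_normed_vector set"
    and f g :: "'a \<Rightarrow> ereal" and h :: "'b \<Rightarrow> ereal"
    and \<Phi> :: "'a \<Rightarrow> 'b \<Rightarrow> real" and \<omega> :: "'b \<Rightarrow> ereal"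
    and f' :: "'a \<Rightarrow> 'a \<Rightarrow>\<^sub>L real"
    and \<Phi>x :: "'a \<Rightarrow> 'b \<Rightarrow> 'a \<Rightarrow>\<^sub>L real" and \<Phi>l :: "'a \<Rightarrow> 'b \<Rightarrow> 'b \<Rightarrow>\<^sub>L real"
    and \<mu> L Lxx Llx Lll :: real
  assumes finite_dim1: "\<exists>B::'a set. finite B \<and> span B = UNIV"
    and finite_dim2: "\<exists>B::'b set. finite B \<and> span B = UNIV"
    and X: "X \<noteq> {}" "closed X" "convex X" "bounded X"
    and \<Lambda>: "\<Lambda> \<noteq> {}" "closed \<Lambda>" "convex \<Lambda>"
    and f_ccp: "convex_closed_proper f"
    and g_ccp: "convex_closed_proper g"
    and h_ccp: "convex_closed_proper h"
    and X_dom_g: "X \<subseteq> ext_dom g"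
    and \<Lambda>_dom_h: "\<Lambda> \<subseteq> ext_dom h"
    and f_diff: "\<exists>U. open U \<and> X \<subseteq> U \<and> U \<subseteq> ext_dom f \<and>
          (\<forall>x\<in>U. has_gradient (\<lambda>y. real_of_ereal (f y)) (f' x) x)"
    and \<mu>_L: "0 < \<mu>" "\<mu> \<le> L"
    and f_strongly_convex: "\<And>x x'. \<lbrakk>x \<in> X; x' \<in> X\<rbrakk> \<Longrightarrow>
          \<mu> / 2 * (norm (x - x'))\<^sup>2
            \<le> real_of_ereal (f x) - real_of_ereal (f x') - blinfun_apply (f' x') (x - x')"
    and f_smooth: "\<And>x x'. \<lbrakk>x \<in> X; x' \<in> X\<rbrakk> \<Longrightarrow>
          real_of_ereal (f x) - real_of_ereal (f x') - blinfun_apply (f' x') (x - x')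
            \<le> L / 2 * (norm (x - x'))\<^sup>2"
    and \<Phi>_convex: "\<And>l. convex_on UNIV (\<lambda>x. \<Phi> x l)"
    and \<Phi>_concave: "\<And>x. concave_on UNIV (\<lambda>l. \<Phi> x l)"
    and \<Phi>_grad_x: "\<And>x l. has_gradient (\<lambda>y. \<Phi> y l) (\<Phi>x x l) x"
    and \<Phi>_grad_l: "\<And>x l. has_gradient (\<lambda>m. \<Phi> x m) (\<Phi>l x l) l"
    and \<Phi>_xx: "\<And>x x' l. \<lbrakk>x \<in> X; x' \<in> X; l \<in> \<Lambda>\<rbrakk> \<Longrightarrow>
          norm (\<Phi>x x l - \<Phi>x x' l) \<le> Lxx * norm (x - x')"
    and \<Phi>_xl: "\<And>x l l'. \<lbrakk>x \<in> X; l \<in> \<Lambda>; l' \<in> \<Lambda>\<rbrakk> \<Longrightarrow>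
          norm (\<Phi>x x l - \<Phi>x x l') \<le> Llx * norm (l - l')"
    and \<Phi>_lx: "\<And>x x' l. \<lbrakk>x \<in> X; x' \<in> X; l \<in> \<Lambda>\<rbrakk> \<Longrightarrow>
          norm (\<Phi>l x l - \<Phi>l x' l) \<le> Llx * norm (x - x')"
    and \<Phi>_ll: "\<And>x l l'. \<lbrakk>x \<in> X; l \<in> \<Lambda>; l' \<in> \<Lambda>\<rbrakk> \<Longrightarrow>
          norm (\<Phi>l x l - \<Phi>l x l') \<le> Lll * norm (l - l')"
    and saddle_exists: "\<exists>xs ls. saddle_point X \<Lambda> (S_fun f g h \<Phi>) xs ls"
    and \<omega>_ccp: "convex_closed_proper \<omega>"
    and \<Lambda>_dom_\<omega>: "\<Lambda> \<subseteq> ext_dom \<omega>"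
    and \<omega>_strongly_convex: "ext_strongly_convex_on 1 \<Lambda> \<omega>"
    and \<omega>_continuous: "continuous_on \<Lambda> \<omega>"
    and \<omega>_smooth: "essentially_smooth \<omega>"

definition LD :: "real \<Rightarrow> real \<Rightarrow> real \<Rightarrow> real" where
  "LD \<mu> Llx Lll = Lll + Llx\<^sup>2 / \<mu>"


section \<open>The deterministic IPDS algorithm\<close>

text \<open>One iteration, from \<open>(x, l, \<rho>)\<close> to \<open>(x', l', \<rho>')\<close>. The inexact solutions of the subproblems
  are arbitrary points meeting the prescribed accuracy: \<open>lt\<close>, \<open>xt\<close>, \<open>lt'\<close> below stand for
  $\widetilde\lambda_{\rho_k,\eta_k}(x^k)$, $\widetilde x_{\gamma_k}(\hat\lambda^k)$ and
  $\widetilde\lambda_{\rho_{k+1},\eta_k}(x^{k+1})$, and \<open>lh\<close> for $\hat\lambda^k$.\<close>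

definition ipds_step ::
  "'a::real_normed_vector set \<Rightarrow> 'b::real_normed_vector set \<Rightarrow> ('a \<Rightarrow> ereal) \<Rightarrow> ('a \<Rightarrow> ereal)
    \<Rightarrow> ('b \<Rightarrow> ereal) \<Rightarrow> ('a \<Rightarrow> 'b \<Rightarrow> real) \<Rightarrow> ('b \<Rightarrow> ereal)
    \<Rightarrow> real \<Rightarrow> real \<Rightarrow> real \<Rightarrow> 'a \<Rightarrow> 'b \<Rightarrow> real \<Rightarrow> 'a \<Rightarrow> 'b \<Rightarrow> real \<Rightarrow> bool" where
  "ipds_step X \<Lambda> f g h \<Phi> \<omega> \<eta> \<gamma> \<tau> x l \<rho> x' l' \<rho>' \<longleftrightarrow>
    (\<exists>lt lh xt lt'.
       lt \<in> \<Lambda> \<and> psiP_hat \<Lambda> h \<Phi> \<omega> \<rho> x - SD_hat h \<Phi> \<omega> \<rho> x lt \<le> ereal \<eta> \<and>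
       lh = \<tau> *\<^sub>R l + (1 - \<tau>) *\<^sub>R lt \<and>
       xt \<in> X \<and> SP_hat f g \<Phi> xt lh - psiD_hat X f g \<Phi> lh \<le> ereal \<gamma> \<and>
       x' = \<tau> *\<^sub>R x + (1 - \<tau>) *\<^sub>R xt \<and>
       \<rho>' = \<tau> * \<rho> \<and>
       lt' \<in> \<Lambda> \<and> psiP_hat \<Lambda> h \<Phi> \<omega> \<rho>' x' - SD_hat h \<Phi> \<omega> \<rho>' x' lt' \<le> ereal \<eta> \<and>
       l' = \<tau> *\<^sub>R l + (1 - \<tau>) *\<^sub>R lt')"

text \<open>The sequences \<open>x\<close>, \<open>l\<close>, \<open>\<rho>\<close> are produced by some run of the algorithm with parameters
  \<open>\<rho> 0\<close>, \<open>\<eta>\<close>, \<open>\<gamma>\<close>, \<open>\<tau>\<close> and starting point \<open>(x 0, l 0)\<close>.\<close>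

definition ipds_run ::
  "'a::real_normed_vector set \<Rightarrow> 'b::real_normed_vector set \<Rightarrow> ('a \<Rightarrow> ereal) \<Rightarrow> ('a \<Rightarrow> ereal)
    \<Rightarrow> ('b \<Rightarrow> ereal) \<Rightarrow> ('a \<Rightarrow> 'b \<Rightarrow> real) \<Rightarrow> ('b \<Rightarrow> ereal)
    \<Rightarrow> (nat \<Rightarrow> real) \<Rightarrow> (nat \<Rightarrow> real) \<Rightarrow> (nat \<Rightarrow> real)
    \<Rightarrow> (nat \<Rightarrow> 'a) \<Rightarrow> (nat \<Rightarrow> 'b) \<Rightarrow> (nat \<Rightarrow> real) \<Rightarrow> bool" where
  "ipds_run X \<Lambda> f g h \<Phi> \<omega> \<eta> \<gamma> \<tau> x l \<rho> \<longleftrightarrow>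
    0 < \<rho> 0 \<and> (\<forall>k. 0 \<le> \<eta> k \<and> 0 \<le> \<gamma> k \<and> 0 < \<tau> k \<and> \<tau> k < 1) \<and> x 0 \<in> X \<and> l 0 \<in> \<Lambda> \<and>
    (\<forall>k. ipds_step X \<Lambda> f g h \<Phi> \<omega> (\<eta> k) (\<gamma> k) (\<tau> k)
           (x k) (l k) (\<rho> k) (x (Suc k)) (l (Suc k)) (\<rho> (Suc k)))"

end

theory Submission
  imports Defs
begin

text \<open>
  The argument is an excessive-gap argument. Let \<open>(x', l')\<close>, with \<open>\<rho>' = \<tau> \<rho>\<close>, be the iterate that
  follows \<open>(x, l)\<close>; \<open>lt\<close>, \<open>xt\<close>, \<open>lt'\<close> are the inexact solutions of the three subproblems, and
  \<open>lh = \<tau> l + (1 - \<tau>) lt\<close>. The aim is the contraction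
  \<open>\<Delta>\<^sub>\<rho>' (x', l') \<le> \<tau> \<Delta>\<^sub>\<rho> (x, l) + (1 + \<tau>) \<eta> + 2 \<gamma>\<close> (lemma \<open>smoothed_gap_step\<close>).

  On the primal side, convexity of \<open>f + g + \<Phi>(\<cdot>, lt')\<close> splits the objective at \<open>x'\<close> into a \<open>\<tau>\<close>-part
  at \<open>x\<close> and a \<open>(1 - \<tau>)\<close>-part at \<open>xt\<close>. In the \<open>\<tau>\<close>-part the point \<open>lt'\<close> competes with the near
  maximiser \<open>lt\<close> of a \<open>\<rho>\<close>-strongly concave function, so it loses \<open>\<rho>/4 \<parallel>lt' - lt\<parallel>\<^sup>2\<close>
  (\<open>dual_growth\<close>). On the dual side, the value function \<open>inf\<^sub>x (f + g + \<Phi>)\<close> has at \<open>lh\<close> the inexact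
  quadratic lower model whose slope is the gradient of \<open>\<Phi>\<close> at \<open>(xt, lh)\<close> and whose curvature is
  \<open>L\<^sub>D\<close> (\<open>dual_lower_model\<close>). Since \<open>l' - lh = (1 - \<tau>) (lt' - lt)\<close>, this costs
  \<open>L\<^sub>D (1 - \<tau>)\<^sup>2 \<parallel>lt' - lt\<parallel>\<^sup>2\<close>, which the gain pays for as soon as \<open>L\<^sub>D (1 - \<tau>)\<^sup>2 \<le> \<tau> \<rho> / 4\<close>
  (\<open>excessive_gap_step\<close>). The choice \<open>\<rho>\<^sub>0 = 8 L\<^sub>D\<close>
  makes this hold at every step, asymptotically with equality.

  Exact minimisers and maximisers never appear: a point that is optimal up to \<open>\<gamma>\<close> is compared with
  another one at their midpoint, and strong convexity there yields quadratic growth up to an error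
  proportional to \<open>\<gamma>\<close>. The subproblem values along a run are finite, being within \<open>\<eta>\<close>
  or \<open>\<gamma>\<close> of a finite number.

  The factors \<open>\<tau>\<^sub>k\<close> telescope to \<open>2 / ((K + 1) (K + 2))\<close>, and the error of step \<open>k\<close> is at most
  \<open>(1 - \<tau>\<^sub>k) \<epsilon>/2\<close>, so that the accumulated error is a convex combination of \<open>0\<close> and \<open>\<epsilon>/2\<close>
  (\<open>contraction_with_error\<close>). If \<open>\<Lambda>\<close> is bounded, the plain gap and the gap smoothed by \<open>\<rho>\<close> differ
  by at most \<open>\<rho> B\<close>, where \<open>B\<close> is the supremum of \<open>\<bar>\<omega>\<bar>\<close> on \<open>\<Lambda>\<close>; passing from one
  to the other at step \<open>0\<close> and back at step \<open>K\<close> costs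
  \<open>16 L\<^sub>D B / ((K + 1) (K + 2))\<close> each time.
\<close>

section \<open>Gradient inequalities and extended-real convexity\<close>

text \<open>Restricting to the line through \<open>x\<close> and \<open>y\<close> reduces this to the tangent inequality for a
  convex function of one real variable.\<close>

lemma convex_gradient_inequality:
  fixes \<phi> :: "'c::real_normed_vector \<Rightarrow> real"
  assumes conv: "convex_on UNIV \<phi>" and grad: "has_gradient \<phi> d x"
  shows "\<phi> x + blinfun_apply d (y - x) \<le> \<phi> y"
proof -
  define \<theta> where "\<theta> = (\<lambda>t::real. \<phi> (x + t *\<^sub>R (y - x)))"
  have "convex_on UNIV \<theta>"
  proof (rule convex_onI)
    fix t a b :: real
    assume "0 < t" "t < 1"
    have "x + ((1 - t) *\<^sub>R a + t *\<^sub>R b) *\<^sub>R (y - x)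
        = (1 - t) *\<^sub>R (x + a *\<^sub>R (y - x)) + t *\<^sub>R (x + b *\<^sub>R (y - x))"
      by (simp add: algebra_simps)
    then show "\<theta> ((1 - t) *\<^sub>R a + t *\<^sub>R b) \<le> (1 - t) * \<theta> a + t * \<theta> b"
      unfolding \<theta>_def
      using convex_onD[OF conv, of t "x + a *\<^sub>R (y - x)" "x + b *\<^sub>R (y - x)"] \<open>0 < t\<close> \<open>t < 1\<close> by simp
  qed simp
  moreover have "(\<theta> has_real_derivative blinfun_apply d (y - x)) (at 0)"
  proof -
    have "((\<lambda>t::real. x + t *\<^sub>R (y - x)) has_derivative (\<lambda>t. t *\<^sub>R (y - x))) (at 0)"
      by (auto intro!: derivative_eq_intros)
    moreover have "(\<phi> has_derivative blinfun_apply d) (at (x + 0 *\<^sub>R (y - x)))"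
      using grad by (simp add: has_gradient_def)
    ultimately have "(\<theta> has_derivative (\<lambda>t. blinfun_apply d (t *\<^sub>R (y - x)))) (at 0)"
      unfolding \<theta>_def using has_derivative_compose by fastforce
    moreover have "(\<lambda>t. blinfun_apply d (t *\<^sub>R (y - x))) = (*) (blinfun_apply d (y - x))"
      by (simp add: fun_eq_iff blinfun.scaleR_right)
    ultimately show ?thesis
      by (simp add: has_field_derivative_def)
  qed
  ultimately have "\<theta> 1 - \<theta> 0 \<ge> blinfun_apply d (y - x) * (1 - 0)"
    by (intro convex_on_imp_above_tangent[where A = UNIV]) auto
  then show ?thesis
    by (simp add: \<theta>_def)
qed

lemma concave_gradient_inequality:
  fixes \<phi> :: "'c::real_normed_vector \<Rightarrow> real"
  assumes "concave_on UNIV \<phi>" and "has_gradient \<phi> d x"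
  shows "\<phi> y \<le> \<phi> x + blinfun_apply d (y - x)"
proof -
  have "has_gradient (\<lambda>y. - \<phi> y) (- d) x"
    using assms(2) unfolding has_gradient_def
    by (auto dest: has_derivative_minus simp: uminus_blinfun.rep_eq fun_Compl_def)
  from convex_gradient_inequality[OF _ this, of y] assms(1) show ?thesis
    by (simp add: concave_on_def uminus_blinfun.rep_eq)
qed

lemma convex_closed_proper_finite:
  assumes "convex_closed_proper F" and "x \<in> ext_dom F"
  shows "F x = ereal (real_of_ereal (F x))"
proof -
  have "F x \<noteq> \<infinity>" "F x \<noteq> -\<infinity>"
    using assms by (auto simp: convex_closed_proper_def ext_proper_def ext_dom_def)
  then show ?thesis by (cases "F x") auto
qed

lemma convex_closed_proper_convex:
  assumes F: "convex_closed_proper F" and x: "x \<in> ext_dom F" and y: "y \<in> ext_dom F"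
    and t: "0 \<le> t" "t \<le> 1"
  shows "real_of_ereal (F (t *\<^sub>R x + (1 - t) *\<^sub>R y))
    \<le> t * real_of_ereal (F x) + (1 - t) * real_of_ereal (F y)"
proof -
  have "(x, real_of_ereal (F x)) \<in> ext_epi F" "(y, real_of_ereal (F y)) \<in> ext_epi F"
    using convex_closed_proper_finite[OF F x] convex_closed_proper_finite[OF F y]
    by (auto simp: ext_epi_def)
  then have "t *\<^sub>R (x, real_of_ereal (F x)) + (1 - t) *\<^sub>R (y, real_of_ereal (F y)) \<in> ext_epi F"
    using F t by (intro convexD) (auto simp: convex_closed_proper_def)
  then have "F (t *\<^sub>R x + (1 - t) *\<^sub>R y)
      \<le> ereal (t * real_of_ereal (F x) + (1 - t) * real_of_ereal (F y))"
    by (simp add: ext_epi_def)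
  moreover have "F (t *\<^sub>R x + (1 - t) *\<^sub>R y) \<noteq> -\<infinity>"
    using F by (simp add: convex_closed_proper_def ext_proper_def)
  ultimately show ?thesis
    by (cases "F (t *\<^sub>R x + (1 - t) *\<^sub>R y)") auto
qed

section \<open>Real-valued form of the problem data\<close>

context saddle_problem
begin

text \<open>On \<open>X\<close> and \<open>\<Lambda>\<close> all the extended-real data are finite; \<open>F\<close>, \<open>H\<close>, \<open>W\<close> carry the estimates
  into the reals, where the arithmetic needs no case distinctions.\<close>

definition F :: "'a \<Rightarrow> real" where "F u = real_of_ereal (f u) + real_of_ereal (g u)"
definition H :: "'b \<Rightarrow> real" where "H m = real_of_ereal (h m)"
definition W :: "'b \<Rightarrow> real" where "W m = real_of_ereal (\<omega> m)"

lemma X_dom_f: "X \<subseteq> ext_dom f"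
  using f_diff by blast

lemma f_g_finite: "u \<in> X \<Longrightarrow> f u + g u = ereal (F u)"
  using convex_closed_proper_finite[OF f_ccp, of u] convex_closed_proper_finite[OF g_ccp, of u]
    X_dom_f X_dom_g
  by (metis F_def plus_ereal.simps(1) subsetD)

lemma h_finite: "m \<in> \<Lambda> \<Longrightarrow> h m = ereal (H m)"
  using convex_closed_proper_finite[OF h_ccp, of m] \<Lambda>_dom_h by (auto simp: H_def)

lemma \<omega>_finite: "m \<in> \<Lambda> \<Longrightarrow> \<omega> m = ereal (W m)"
  using convex_closed_proper_finite[OF \<omega>_ccp, of m] \<Lambda>_dom_\<omega> by (auto simp: W_def)

lemma SP_hat_finite: "u \<in> X \<Longrightarrow> SP_hat f g \<Phi> u m = ereal (F u + \<Phi> u m)"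
  by (simp add: SP_hat_def f_g_finite)

lemma SD_hat_finite: "m \<in> \<Lambda> \<Longrightarrow> SD_hat h \<Phi> \<omega> r u m = ereal (\<Phi> u m - H m - r * W m)"
  by (simp add: SD_hat_def h_finite \<omega>_finite)

lemma F_convex:
  assumes "u \<in> X" "v \<in> X" "0 \<le> t" "t \<le> 1"
  shows "F (t *\<^sub>R u + (1 - t) *\<^sub>R v) \<le> t * F u + (1 - t) * F v"
proof -
  have "u \<in> ext_dom f" "v \<in> ext_dom f" "u \<in> ext_dom g" "v \<in> ext_dom g"
    using assms X_dom_f X_dom_g by auto
  then show ?thesis
    using convex_closed_proper_convex[OF f_ccp, of u v t]
      convex_closed_proper_convex[OF g_ccp, of u v t] assms
    by (simp add: F_def algebra_simps)
qed

lemma H_convex: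
  assumes "m \<in> \<Lambda>" "n \<in> \<Lambda>" "0 \<le> t" "t \<le> 1"
  shows "H (t *\<^sub>R m + (1 - t) *\<^sub>R n) \<le> t * H m + (1 - t) * H n"
  using convex_closed_proper_convex[OF h_ccp, of m n t] assms \<Lambda>_dom_h by (auto simp: H_def)

lemma \<Phi>_convex_comb:
  assumes "0 \<le> t" "t \<le> 1"
  shows "\<Phi> (t *\<^sub>R u + (1 - t) *\<^sub>R v) m \<le> t * \<Phi> u m + (1 - t) * \<Phi> v m"
  using convex_onD[OF \<Phi>_convex[of m], of "1 - t" u v] assms by simp

lemma \<Phi>_concave_comb:
  assumes "0 \<le> t" "t \<le> 1"
  shows "t * \<Phi> u m + (1 - t) * \<Phi> u n \<le> \<Phi> u (t *\<^sub>R m + (1 - t) *\<^sub>R n)"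
  using convex_onD[OF \<Phi>_concave[of u, unfolded concave_on_def], of "1 - t" m n] assms
  by (simp add: algebra_simps)

lemma X_comb: "u \<in> X \<Longrightarrow> v \<in> X \<Longrightarrow> 0 \<le> t \<Longrightarrow> t \<le> 1 \<Longrightarrow> t *\<^sub>R u + (1 - t) *\<^sub>R v \<in> X"
  using X(3) by (simp add: convexD)

lemma \<Lambda>_comb: "m \<in> \<Lambda> \<Longrightarrow> n \<in> \<Lambda> \<Longrightarrow> 0 \<le> t \<Longrightarrow> t \<le> 1 \<Longrightarrow> t *\<^sub>R m + (1 - t) *\<^sub>R n \<in> \<Lambda>"
  using \<Lambda>(3) by (simp add: convexD)

section \<open>Quadratic growth around inexact optimisers\<close>

text \<open>Strong convexity is given in gradient form. Applying it at the midpoint \<open>w\<close> towards both ends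
  makes the two linear terms cancel.\<close>

lemma F_strongly_midconvex:
  assumes u: "u \<in> X" and v: "v \<in> X"
  shows "F ((1/2) *\<^sub>R u + (1 - 1/2) *\<^sub>R v) + \<mu> / 8 * (norm (u - v))\<^sup>2 \<le> (F u + F v) / 2"
proof -
  define w where "w = (1/2::real) *\<^sub>R u + (1 - 1/2::real) *\<^sub>R v"
  have w: "w \<in> X"
    unfolding w_def by (intro X_comb u v) auto
  have uw: "u - w = (1/2) *\<^sub>R (u - v)"
    unfolding w_def by (simp add: algebra_simps)
      (metis add.commute add_diff_eq diff_add_cancel scaleR_add_right scaleR_half_double)
  have vw: "v - w = - ((1/2) *\<^sub>R (u - v))"
    unfolding w_def by (simp add: algebra_simps)
      (metis add.commute add_diff_eq diff_add_cancel scaleR_add_right scaleR_half_double)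
  let ?d = "blinfun_apply (f' w) ((1/2) *\<^sub>R (u - v))"
  let ?f = "\<lambda>u. real_of_ereal (f u)" let ?g = "\<lambda>u. real_of_ereal (g u)"
  have "\<mu> / 2 * (norm (u - v) / 2)\<^sup>2 \<le> ?f u - ?f w - ?d"
    using f_strongly_convex[OF u w] by (simp add: uw)
  moreover have "\<mu> / 2 * (norm (u - v) / 2)\<^sup>2 \<le> ?f v - ?f w + ?d"
    using f_strongly_convex[OF v w] by (simp add: vw blinfun.minus_right)
  moreover have "?g w \<le> 1/2 * ?g u + (1 - 1/2) * ?g v"
    unfolding w_def using u v X_dom_g by (intro convex_closed_proper_convex[OF g_ccp]) auto
  ultimately show ?thesis
    unfolding w_def[symmetric] F_def by (simp add: power_divide field_simps)
qed

lemma W_strongly_midconvex: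
  assumes m: "m \<in> \<Lambda>" and n: "n \<in> \<Lambda>"
  shows "W ((1/2) *\<^sub>R m + (1 - 1/2) *\<^sub>R n) + 1 / 8 * (norm (m - n))\<^sup>2 \<le> (W m + W n) / 2"
proof -
  have c: "(1/2) *\<^sub>R m + (1/2) *\<^sub>R n \<in> \<Lambda>"
    using \<Lambda>_comb[OF m n, of "1/2"] by simp
  have "(1/2::real) \<in> {0..1}" by simp
  from \<omega>_strongly_convex[unfolded ext_strongly_convex_on_def, rule_format, OF m n this]
  show ?thesis
    by (simp add: \<omega>_finite[OF c] \<omega>_finite[OF m] \<omega>_finite[OF n] field_simps)
qed

text \<open>The midpoint of \<open>u\<close> and the near minimiser \<open>xt\<close> cannot go below \<open>V\<close>; the surplus of strong
  convexity at the midpoint must therefore show up in the value at \<open>u\<close>.\<close>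

lemma primal_growth:
  assumes xt: "xt \<in> X" and u: "u \<in> X"
    and low: "\<And>u. u \<in> X \<Longrightarrow> V \<le> F u + \<Phi> u m" and opt: "F xt + \<Phi> xt m \<le> V + c"
  shows "V - c + \<mu> / 4 * (norm (u - xt))\<^sup>2 \<le> F u + \<Phi> u m"
proof -
  have "V \<le> F ((1/2) *\<^sub>R u + (1 - 1/2) *\<^sub>R xt) + \<Phi> ((1/2) *\<^sub>R u + (1 - 1/2) *\<^sub>R xt) m"
    by (intro low X_comb u xt) auto
  then show ?thesis
    using F_strongly_midconvex[OF u xt] \<Phi>_convex_comb[of "1/2" u xt m] opt
    by (simp add: field_simps)
qed

lemma dual_growth:
  assumes lt: "lt \<in> \<Lambda>" and n: "n \<in> \<Lambda>" and r: "0 \<le> r"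
    and up: "\<And>m. m \<in> \<Lambda> \<Longrightarrow> \<Phi> u m - H m - r * W m \<le> M"
    and opt: "M \<le> \<Phi> u lt - H lt - r * W lt + c"
  shows "\<Phi> u n - H n - r * W n \<le> M + c - r / 4 * (norm (n - lt))\<^sup>2"
proof -
  let ?w = "(1/2) *\<^sub>R n + (1 - 1/2) *\<^sub>R lt"
  have "\<Phi> u ?w - H ?w - r * W ?w \<le> M"
    by (intro up \<Lambda>_comb n lt) auto
  moreover have "r * (W ?w + 1 / 8 * (norm (n - lt))\<^sup>2) \<le> r * ((W n + W lt) / 2)"
    by (intro mult_left_mono W_strongly_midconvex n lt r)
  ultimately show ?thesis
    using \<Phi>_concave_comb[of "1/2" u n lt] H_convex[OF n lt, of "1/2"] opt
    by (simp add: field_simps)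
qed

section \<open>One step of the algorithm\<close>

text \<open>This replaces the descent lemma for the dual value function, whose gradient at \<open>lh\<close> would
  require the exact minimiser. For each competitor \<open>u\<close>, concavity of \<open>\<Phi>(u, \<cdot>)\<close> and the Lipschitz
  bound in the second argument give a quadratic lower bound with slope \<open>\<Phi>l u lh\<close>. Replacing that
  slope by \<open>\<Phi>l xt lh\<close> costs a term linear in \<open>\<parallel>u - xt\<parallel>\<close>, which the growth \<open>\<mu>/4 \<parallel>u - xt\<parallel>\<^sup>2\<close> absorbs
  at the price of \<open>Llx\<^sup>2/\<mu>\<close> in the curvature. Using the gradient at the far end \<open>n\<close>, instead of
  integrating along the segment, gives \<open>Lll\<close> in place of \<open>Lll/2\<close>, so that the two contributions add
  up to precisely \<open>L\<^sub>D\<close>.\<close>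

lemma dual_lower_model:
  assumes xt: "xt \<in> X" and u: "u \<in> X" and lh: "lh \<in> \<Lambda>" and n: "n \<in> \<Lambda>"
    and low: "\<And>u. u \<in> X \<Longrightarrow> V \<le> F u + \<Phi> u lh" and opt: "F xt + \<Phi> xt lh \<le> V + c"
  shows "F xt + \<Phi> xt lh + blinfun_apply (\<Phi>l xt lh) (n - lh) - 2 * c
      - LD \<mu> Llx Lll * (norm (n - lh))\<^sup>2 \<le> F u + \<Phi> u n"
proof -
  define r where "r = norm (u - xt)"
  define d where "d = norm (n - lh)"
  have "\<Phi> u lh \<le> \<Phi> u n + blinfun_apply (\<Phi>l u n) (lh - n)"
    by (rule concave_gradient_inequality[OF \<Phi>_concave \<Phi>_grad_l])
  moreover have "blinfun_apply (\<Phi>l u n) (lh - n) = - blinfun_apply (\<Phi>l u n) (n - lh)"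
    by (simp add: blinfun.diff_right)
  moreover have "\<bar>blinfun_apply (\<Phi>l u n - \<Phi>l u lh) (n - lh)\<bar> \<le> Lll * d * d"
    unfolding d_def using norm_blinfun[of "\<Phi>l u n - \<Phi>l u lh" "n - lh"] \<Phi>_ll[OF u n lh]
    by (smt (verit) mult_right_mono norm_ge_zero real_norm_def)
  moreover have "\<bar>blinfun_apply (\<Phi>l u lh - \<Phi>l xt lh) (n - lh)\<bar> \<le> Llx * r * d"
    unfolding d_def r_def using norm_blinfun[of "\<Phi>l u lh - \<Phi>l xt lh" "n - lh"] \<Phi>_lx[OF u xt lh]
    by (smt (verit) mult_right_mono norm_ge_zero real_norm_def)
  moreover have "V - c + \<mu> / 4 * r\<^sup>2 \<le> F u + \<Phi> u lh"
    unfolding r_def by (rule primal_growth[OF xt u low opt])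
  moreover have "Llx * r * d \<le> \<mu> / 4 * r\<^sup>2 + Llx\<^sup>2 / \<mu> * d\<^sup>2"
  proof -
    \<comment> \<open>Young's inequality, as a completed square.\<close>
    have "0 \<le> (\<mu> * r / 2 - Llx * d)\<^sup>2 / \<mu>"
      using \<mu>_L by simp
    also have "\<dots> = \<mu> / 4 * r\<^sup>2 + Llx\<^sup>2 / \<mu> * d\<^sup>2 - Llx * r * d"
      using \<mu>_L by (simp add: power2_eq_square field_simps)
    finally show ?thesis by simp
  qed
  ultimately show ?thesis
    using opt unfolding d_def[symmetric] LD_def
    by (simp add: blinfun.diff_left power2_eq_square algebra_simps)
qed

text \<open>The heart of the proof: the primal gain \<open>\<tau> \<rho>/4 \<parallel>lt' - lt\<parallel>\<^sup>2\<close> and the dual loss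
  \<open>L\<^sub>D (1 - \<tau>)\<^sup>2 \<parallel>lt' - lt\<parallel>\<^sup>2\<close> meet. Here \<open>M\<close> plays the role of the smoothed primal value at \<open>x\<close> and
  \<open>A\<close> that of the dual value at \<open>l\<close>, while \<open>u\<close> ranges over the competitors that define the dual value
  at \<open>l'\<close>.\<close>

lemma excessive_gap_step:
  assumes x: "x \<in> X" and xt: "xt \<in> X" and l: "l \<in> \<Lambda>" and lt: "lt \<in> \<Lambda>" and lt': "lt' \<in> \<Lambda>"
    and t: "0 < t" "t < 1" and r: "0 \<le> r" and balance: "LD \<mu> Llx Lll * (1 - t)\<^sup>2 \<le> t * r / 4"
    and lh: "lh = t *\<^sub>R l + (1 - t) *\<^sub>R lt"
    and x': "x' = t *\<^sub>R x + (1 - t) *\<^sub>R xt"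
    and l': "l' = t *\<^sub>R l + (1 - t) *\<^sub>R lt'"
    and up: "\<And>m. m \<in> \<Lambda> \<Longrightarrow> \<Phi> x m - H m - r * W m \<le> M"
    and lt_opt: "M \<le> \<Phi> x lt - H lt - r * W lt + e"
    and low: "\<And>u. u \<in> X \<Longrightarrow> V \<le> F u + \<Phi> u lh" and xt_opt: "F xt + \<Phi> xt lh \<le> V + c"
    and A: "\<And>u. u \<in> X \<Longrightarrow> A \<le> F u + \<Phi> u l"
    and u: "u \<in> X"
  shows "F x' + (\<Phi> x' lt' - H lt' - t * r * W lt') - (F u + \<Phi> u l' - H l')
    \<le> t * (F x + M - (A - H l)) + t * e + 2 * c"
proof -
  define D where "D = norm (lt' - lt)"
  let ?G = "blinfun_apply (\<Phi>l xt lh)"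
  have lh\<Lambda>: "lh \<in> \<Lambda>" and l'\<Lambda>: "l' \<in> \<Lambda>"
    unfolding lh l' using l lt lt' t by (auto intro!: \<Lambda>_comb)
  have "l' - lh = (1 - t) *\<^sub>R (lt' - lt)"
    by (simp add: lh l' algebra_simps)
  then have norm: "norm (l' - lh) = (1 - t) * D"
    using t by (simp add: D_def)
  \<comment> \<open>The slope term splits into the two that bound \<open>\<Phi> xt\<close> from above at \<open>l\<close> and at \<open>lt'\<close>.\<close>
  have "l' - lh = t *\<^sub>R (l - lh) + (1 - t) *\<^sub>R (lt' - lh)"
    by (simp add: l' algebra_simps)
  then have G: "?G (l' - lh) = t * ?G (l - lh) + (1 - t) * ?G (lt' - lh)"
    by (simp add: blinfun.add_right blinfun.scaleR_right)
  have "F xt + \<Phi> xt lh + ?G (l' - lh) - 2 * c - LD \<mu> Llx Lll * ((1 - t) * D)\<^sup>2 \<le> F u + \<Phi> u l'"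
    using dual_lower_model[OF xt u lh\<Lambda> l'\<Lambda> low xt_opt] by (simp add: norm)
  moreover have "t * A \<le> t * (F xt + \<Phi> xt lh + ?G (l - lh))"
    using A[OF xt] concave_gradient_inequality[OF \<Phi>_concave \<Phi>_grad_l, of xt l lh] t
    by (intro mult_left_mono) auto
  moreover have "(1 - t) * \<Phi> xt lt' \<le> (1 - t) * (\<Phi> xt lh + ?G (lt' - lh))"
    using concave_gradient_inequality[OF \<Phi>_concave \<Phi>_grad_l, of xt lt' lh] t
    by (intro mult_left_mono) auto
  ultimately have dual: "t * A + (1 - t) * (F xt + \<Phi> xt lt') - 2 * c
      - LD \<mu> Llx Lll * ((1 - t) * D)\<^sup>2 \<le> F u + \<Phi> u l'"
    unfolding G by (simp add: algebra_simps)
  have "t * (\<Phi> x lt' - H lt' - r * W lt') \<le> t * (M + e - r / 4 * D\<^sup>2)"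
    unfolding D_def using t by (intro mult_left_mono dual_growth lt lt' r up lt_opt) auto
  moreover have "F x' \<le> t * F x + (1 - t) * F xt"
    unfolding x' using t by (intro F_convex x xt) auto
  moreover have "\<Phi> x' lt' \<le> t * \<Phi> x lt' + (1 - t) * \<Phi> xt lt'"
    unfolding x' using t by (intro \<Phi>_convex_comb) auto
  moreover have "H l' \<le> t * H l + (1 - t) * H lt'"
    unfolding l' using t by (intro H_convex l lt') auto
  moreover have "LD \<mu> Llx Lll * ((1 - t) * D)\<^sup>2 \<le> t * r / 4 * D\<^sup>2"
    using mult_right_mono[OF balance, of "D\<^sup>2"] by (simp add: power_mult_distrib mult.assoc)
  ultimately show ?thesis
    using dual by (simp add: algebra_simps)
qed

text \<open>The accuracy certificate of a subproblem already forces its value to be finite: it lies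
  within the accuracy of the finite value at the certified point.\<close>

lemma near_maximiser_real:
  assumes "lt \<in> \<Lambda>" and "psiP_hat \<Lambda> h \<Phi> \<omega> r u - SD_hat h \<Phi> \<omega> r u lt \<le> ereal e"
  obtains M where "psiP_hat \<Lambda> h \<Phi> \<omega> r u = ereal M"
    and "\<And>m. m \<in> \<Lambda> \<Longrightarrow> \<Phi> u m - H m - r * W m \<le> M"
    and "M \<le> \<Phi> u lt - H lt - r * W lt + e"
proof -
  have up: "ereal (\<Phi> u m - H m - r * W m) \<le> psiP_hat \<Lambda> h \<Phi> \<omega> r u" if "m \<in> \<Lambda>" for m
    unfolding psiP_hat_def using that by (metis SD_hat_finite SUP_upper)
  show ?thesis
  proof (cases "psiP_hat \<Lambda> h \<Phi> \<omega> r u")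
    case (real M)
    then show ?thesis
      using assms up by (intro that[of M]) (auto simp: SD_hat_finite)
  qed (use assms up[of lt] in \<open>auto simp: SD_hat_finite\<close>)
qed

lemma psiD_hat_le: "u \<in> X \<Longrightarrow> psiD_hat X f g \<Phi> m \<le> ereal (F u + \<Phi> u m)"
  unfolding psiD_hat_def by (metis SP_hat_finite INF_lower)

lemma near_minimiser_real:
  assumes "xt \<in> X" and "SP_hat f g \<Phi> xt m - psiD_hat X f g \<Phi> m \<le> ereal c"
  obtains V where "\<And>u. u \<in> X \<Longrightarrow> V \<le> F u + \<Phi> u m" and "F xt + \<Phi> xt m \<le> V + c"
proof (cases "psiD_hat X f g \<Phi> m")
  case (real V)
  then show ?thesis
    using assms psiD_hat_le[of _ m] by (intro that[of V]) (auto simp: SP_hat_finite)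
qed (use assms psiD_hat_le[of xt m] in \<open>auto simp: SP_hat_finite\<close>)

text \<open>The dual value at \<open>l\<close> may be taken to be finite: otherwise the right-hand side is infinite,
  because the smoothed primal value is finite.\<close>

lemma smoothed_gap_step:
  assumes step: "ipds_step X \<Lambda> f g h \<Phi> \<omega> e c t x l r x' l' r'"
    and x: "x \<in> X" and l: "l \<in> \<Lambda>" and t: "0 < t" "t < 1" and r: "0 \<le> r"
    and balance: "LD \<mu> Llx Lll * (1 - t)\<^sup>2 \<le> t * r / 4"
  shows "smoothed_gap X \<Lambda> f g h \<Phi> \<omega> r' x' l'
    \<le> ereal t * smoothed_gap X \<Lambda> f g h \<Phi> \<omega> r x l + ereal ((1 + t) * e + 2 * c)"
proof -
  obtain lt lh xt lt' where
    lt: "lt \<in> \<Lambda>" "psiP_hat \<Lambda> h \<Phi> \<omega> r x - SD_hat h \<Phi> \<omega> r x lt \<le> ereal e" and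
    lh: "lh = t *\<^sub>R l + (1 - t) *\<^sub>R lt" and
    xt: "xt \<in> X" "SP_hat f g \<Phi> xt lh - psiD_hat X f g \<Phi> lh \<le> ereal c" and
    x': "x' = t *\<^sub>R x + (1 - t) *\<^sub>R xt" and r': "r' = t * r" and
    lt': "lt' \<in> \<Lambda>" "psiP_hat \<Lambda> h \<Phi> \<omega> r' x' - SD_hat h \<Phi> \<omega> r' x' lt' \<le> ereal e" and
    l': "l' = t *\<^sub>R l + (1 - t) *\<^sub>R lt'"
    using step unfolding ipds_step_def by blast
  have x'X: "x' \<in> X" and l'\<Lambda>: "l' \<in> \<Lambda>"
    unfolding x' l' using t by (auto intro!: X_comb \<Lambda>_comb x l xt(1) lt'(1))
  obtain M where M: "psiP_hat \<Lambda> h \<Phi> \<omega> r x = ereal M"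
      "\<And>m. m \<in> \<Lambda> \<Longrightarrow> \<Phi> x m - H m - r * W m \<le> M" "M \<le> \<Phi> x lt - H lt - r * W lt + e"
    using near_maximiser_real[OF lt] by blast
  obtain M' where M': "psiP_hat \<Lambda> h \<Phi> \<omega> r' x' = ereal M'"
      "M' \<le> \<Phi> x' lt' - H lt' - r' * W lt' + e"
    using near_maximiser_real[OF lt'] by blast
  obtain V where V: "\<And>u. u \<in> X \<Longrightarrow> V \<le> F u + \<Phi> u lh" "F xt + \<Phi> xt lh \<le> V + c"
    using near_minimiser_real[OF xt] by blast
  have gap: "smoothed_gap X \<Lambda> f g h \<Phi> \<omega> r x l = ereal (F x + M) - (psiD_hat X f g \<Phi> l - ereal (H l))"
    by (simp add: smoothed_gap_def psiP_smoothed_def psiD_def f_g_finite x h_finite l M(1))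
  have gap': "smoothed_gap X \<Lambda> f g h \<Phi> \<omega> r' x' l'
      = ereal (F x' + M') - (psiD_hat X f g \<Phi> l' - ereal (H l'))"
    by (simp add: smoothed_gap_def psiP_smoothed_def psiD_def f_g_finite x'X h_finite l'\<Lambda> M'(1))
  show ?thesis
  proof (cases "psiD_hat X f g \<Phi> l")
    case (real A)
    have A: "A \<le> F u + \<Phi> u l" if "u \<in> X" for u
      using psiD_hat_le[OF that, of l] real by simp
    let ?B = "F x' + M' + H l' - (t * (F x + M - (A - H l)) + (1 + t) * e + 2 * c)"
    have "?B \<le> F u + \<Phi> u l'" if u: "u \<in> X" for u
      using excessive_gap_step[OF x xt(1) l lt(1) lt'(1) t r balance lh x' l' M(2,3) V A u] M'(2)
      by (simp add: r' algebra_simps)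
    then have "ereal ?B \<le> psiD_hat X f g \<Phi> l'"
      unfolding psiD_hat_def by (intro INF_greatest) (simp add: SP_hat_finite)
    then show ?thesis
      unfolding gap gap' real by (cases "psiD_hat X f g \<Phi> l'") (auto simp: algebra_simps)
  next
    case PInf
    then show ?thesis using psiD_hat_le[OF x, of l] by simp
  next
    case MInf
    then show ?thesis unfolding gap using t by simp
  qed
qed

section \<open>Smoothed and plain duality gap\<close>

lemma psiP_hat_not_MInf: "psiP_hat \<Lambda> h \<Phi> \<omega> r u \<noteq> -\<infinity>"
proof -
  obtain m where m: "m \<in> \<Lambda>" using \<Lambda>(1) by blast
  then have "ereal (\<Phi> u m - H m - r * W m) \<le> psiP_hat \<Lambda> h \<Phi> \<omega> r u"
    unfolding psiP_hat_def by (metis SD_hat_finite SUP_upper)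
  then show ?thesis by auto
qed

lemma S_fun_finite:
  "u \<in> X \<Longrightarrow> m \<in> \<Lambda> \<Longrightarrow> S_fun f g h \<Phi> u m = ereal (F u + \<Phi> u m - H m)"
  by (simp add: S_fun_def f_g_finite h_finite)

lemma duality_gap_le_smoothed_gap:
  assumes u: "u \<in> X" and r: "0 \<le> r" and B: "\<And>m. m \<in> \<Lambda> \<Longrightarrow> \<bar>W m\<bar> \<le> B"
  shows "duality_gap X \<Lambda> f g h \<Phi> u n \<le> smoothed_gap X \<Lambda> f g h \<Phi> \<omega> r u n + ereal (r * B)"
proof -
  have "psiP \<Lambda> f g h \<Phi> u \<le> psiP_smoothed \<Lambda> f g h \<Phi> \<omega> r u + ereal (r * B)"
  proof (cases "psiP_hat \<Lambda> h \<Phi> \<omega> r u")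
    case (real M)
    show ?thesis
      unfolding psiP_def
    proof (rule SUP_least)
      fix m assume m: "m \<in> \<Lambda>"
      have "ereal (\<Phi> u m - H m - r * W m) \<le> ereal M"
        using m real unfolding psiP_hat_def by (metis SD_hat_finite SUP_upper)
      moreover have "r * W m \<le> r * B"
        using B[OF m] r by (intro mult_left_mono) auto
      ultimately show "S_fun f g h \<Phi> u m \<le> psiP_smoothed \<Lambda> f g h \<Phi> \<omega> r u + ereal (r * B)"
        by (simp add: S_fun_finite u m psiP_smoothed_def f_g_finite real)
    qed
  qed (auto simp: psiP_smoothed_def f_g_finite u psiP_hat_not_MInf)
  then show ?thesis
    unfolding duality_gap_def smoothed_gap_def
    by (cases "psiP \<Lambda> f g h \<Phi> u"; cases "psiP_smoothed \<Lambda> f g h \<Phi> \<omega> r u";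
        cases "psiD X f g h \<Phi> n") auto
qed

lemma smoothed_gap_le_duality_gap:
  assumes u: "u \<in> X" and r: "0 \<le> r" and B: "\<And>m. m \<in> \<Lambda> \<Longrightarrow> \<bar>W m\<bar> \<le> B"
  shows "smoothed_gap X \<Lambda> f g h \<Phi> \<omega> r u n \<le> duality_gap X \<Lambda> f g h \<Phi> u n + ereal (r * B)"
proof -
  have S_le: "ereal (F u + \<Phi> u m - H m) \<le> psiP \<Lambda> f g h \<Phi> u" if "m \<in> \<Lambda>" for m
    unfolding psiP_def using that u by (metis S_fun_finite SUP_upper)
  have "psiP_smoothed \<Lambda> f g h \<Phi> \<omega> r u \<le> psiP \<Lambda> f g h \<Phi> u + ereal (r * B)"
  proof (cases "psiP \<Lambda> f g h \<Phi> u")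
    case (real p)
    have "psiP_hat \<Lambda> h \<Phi> \<omega> r u \<le> ereal (p + r * B - F u)"
      unfolding psiP_hat_def
    proof (rule SUP_least)
      fix m assume m: "m \<in> \<Lambda>"
      have "r * (- W m) \<le> r * B"
        using B[OF m] r by (intro mult_left_mono) auto
      then show "SD_hat h \<Phi> \<omega> r u m \<le> ereal (p + r * B - F u)"
        using S_le[OF m] by (simp add: SD_hat_finite m real)
    qed
    then show ?thesis
      unfolding psiP_smoothed_def f_g_finite[OF u] real
      by (cases "psiP_hat \<Lambda> h \<Phi> \<omega> r u") auto
  next
    case MInf
    then show ?thesis using S_le \<Lambda>(1) by fastforce
  qed simp
  then show ?thesis
    unfolding duality_gap_def smoothed_gap_def
    by (cases "psiP \<Lambda> f g h \<Phi> u"; cases "psiP_smoothed \<Lambda> f g h \<Phi> \<omega> r u";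
        cases "psiD X f g h \<Phi> n") auto
qed

section \<open>Convergence rate\<close>

lemma ipds_run_in_domain:
  assumes "ipds_run X \<Lambda> f g h \<Phi> \<omega> \<eta> \<gamma> \<tau> x l \<rho>"
  shows "x k \<in> X \<and> l k \<in> \<Lambda>"
proof (induction k)
  case 0
  show ?case using assms by (simp add: ipds_run_def)
next
  case (Suc k)
  have "ipds_step X \<Lambda> f g h \<Phi> \<omega> (\<eta> k) (\<gamma> k) (\<tau> k)
      (x k) (l k) (\<rho> k) (x (Suc k)) (l (Suc k)) (\<rho> (Suc k))" and "0 < \<tau> k" "\<tau> k < 1"
    using assms by (auto simp: ipds_run_def)
  then show ?case
    using Suc by (auto simp: ipds_step_def intro!: X_comb \<Lambda>_comb)
qed

end

text \<open>An error of the form \<open>(1 - \<tau>\<^sub>k) b\<close> bounds each value by a convex combination of the previous one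
  and \<open>b\<close>, hence the accumulated error never exceeds \<open>b\<close>. The values are extended reals because the
  initial gap may be infinite.\<close>

lemma contraction_with_error:
  fixes G :: "nat \<Rightarrow> ereal" and \<tau> P :: "nat \<Rightarrow> real"
  assumes step: "\<And>k. G (Suc k) \<le> ereal (\<tau> k) * G k + ereal ((1 - \<tau> k) * b)"
    and \<tau>: "\<And>k. 0 < \<tau> k" and P0: "P 0 = 1" and PS: "\<And>k. P (Suc k) = \<tau> k * P k"
  shows "G k \<le> ereal (P k) * G 0 + ereal ((1 - P k) * b)"
proof (induction k)
  case 0
  show ?case by (simp add: P0)
next
  case (Suc k)
  have "0 < P k" for k
    by (induction k) (simp_all add: P0 PS \<tau>)
  note P = this[of k]
  have "G (Suc k) \<le> ereal (\<tau> k) * G k + ereal ((1 - \<tau> k) * b)"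
    by (rule step)
  also have "\<dots> \<le> ereal (\<tau> k) * (ereal (P k) * G 0 + ereal ((1 - P k) * b)) + ereal ((1 - \<tau> k) * b)"
    using \<tau>[of k] by (intro add_right_mono ereal_mult_left_mono Suc) simp
  also have "\<dots> = ereal (P (Suc k)) * G 0 + ereal ((1 - P (Suc k)) * b)"
    using \<tau>[of k] P by (cases "G 0") (auto simp: PS algebra_simps)
  finally show ?case .
qed

theorem theorem3p5:
  fixes X :: "'a::real_normed_vector set" and \<Lambda> :: "'b::real_normed_vector set"
    and f g :: "'a \<Rightarrow> ereal" and h :: "'b \<Rightarrow> ereal"
    and \<Phi> :: "'a \<Rightarrow> 'b \<Rightarrow> real" and \<omega> :: "'b \<Rightarrow> ereal"
    and f' :: "'a \<Rightarrow> 'a \<Rightarrow>\<^sub>L real"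
    and \<Phi>x :: "'a \<Rightarrow> 'b \<Rightarrow> 'a \<Rightarrow>\<^sub>L real" and \<Phi>l :: "'a \<Rightarrow> 'b \<Rightarrow> 'b \<Rightarrow>\<^sub>L real"
    and \<mu> L Lxx Llx Lll \<epsilon> :: real
    and \<eta> \<gamma> \<tau> \<rho> :: "nat \<Rightarrow> real" and x :: "nat \<Rightarrow> 'a" and l :: "nat \<Rightarrow> 'b"
    and K :: nat
  assumes problem: "saddle_problem X \<Lambda> f g h \<Phi> \<omega> f' \<Phi>x \<Phi>l \<mu> L Lxx Llx Lll"
    and \<epsilon>: "0 < \<epsilon>"
    and run: "ipds_run X \<Lambda> f g h \<Phi> \<omega> \<eta> \<gamma> \<tau> x l \<rho>"
    and \<rho>0: "\<rho> 0 = 8 * LD \<mu> Llx Lll"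
    and \<tau>: "\<And>k. \<tau> k = (real k + 1) / (real k + 3)"
    and \<gamma>: "\<And>k. \<gamma> k = \<epsilon> / (4 * (real k + 3))"
    and \<eta>: "\<And>k. \<eta> k = \<epsilon> / (4 * (real k + 3))"
  shows "smoothed_gap X \<Lambda> f g h \<Phi> \<omega> (\<rho> K) (x K) (l K)
           \<le> 2 * smoothed_gap X \<Lambda> f g h \<Phi> \<omega> (\<rho> 0) (x 0) (l 0)
               / ereal ((real K + 1) * (real K + 2)) + ereal (\<epsilon> / 2)
       \<and> (bounded \<Lambda> \<longrightarrow>
         duality_gap X \<Lambda> f g h \<Phi> (x K) (l K)
           \<le> (ereal (32 * LD \<mu> Llx Lll) * (SUP m\<in>\<Lambda>. \<bar>\<omega> m\<bar>)
                + 2 * duality_gap X \<Lambda> f g h \<Phi> (x 0) (l 0))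
               / ereal ((real K + 1) * (real K + 2)) + ereal (\<epsilon> / 2))"
proof -
  interpret saddle_problem X \<Lambda> f g h \<Phi> \<omega> f' \<Phi>x \<Phi>l \<mu> L Lxx Llx Lll
    by (fact problem)
  let ?gap = "\<lambda>k. smoothed_gap X \<Lambda> f g h \<Phi> \<omega> (\<rho> k) (x k) (l k)"
  let ?LD = "LD \<mu> Llx Lll"
  define P where "P k = 2 / ((real k + 1) * (real k + 2))" for k
  have step: "ipds_step X \<Lambda> f g h \<Phi> \<omega> (\<eta> k) (\<gamma> k) (\<tau> k)
      (x k) (l k) (\<rho> k) (x (Suc k)) (l (Suc k)) (\<rho> (Suc k))" for k
    using run by (simp add: ipds_run_def)
  have \<tau>01: "0 < \<tau> k" "\<tau> k < 1" for k
    using run by (auto simp: ipds_run_def)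
  have LD: "0 < ?LD"
    using run \<rho>0 by (simp add: ipds_run_def)
  have P0: "P 0 = 1"
    by (simp add: P_def)
  have PS: "P (Suc k) = \<tau> k * P k" for k
  proof -
    have "real k + 1 \<noteq> 0" "real k + 2 \<noteq> 0" "real k + 3 \<noteq> 0"
      by linarith+
    then show ?thesis
      unfolding P_def \<tau> by (simp add: divide_simps) (simp add: algebra_simps)
  qed
  have \<rho>_eq: "\<rho> k = 8 * ?LD * P k" for k
  proof (induction k)
    case (Suc k)
    have "\<rho> (Suc k) = \<tau> k * \<rho> k"
      using step[of k] by (auto simp: ipds_step_def)
    then show ?case by (simp add: Suc PS)
  qed (simp add: P0 \<rho>0)
  have dom: "x k \<in> X" "l k \<in> \<Lambda>" for k
    using ipds_run_in_domain[OF run] by auto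
  have P_pos: "0 < P k" for k
    by (simp add: P_def)
  have \<rho>_pos: "0 < \<rho> k" for k
    using LD P_pos by (simp add: \<rho>_eq)

  have gap_step: "?gap (Suc k) \<le> ereal (\<tau> k) * ?gap k + ereal ((1 - \<tau> k) * (\<epsilon> / 2))" for k
  proof -
    \<comment> \<open>The gain \<open>\<tau>\<^sub>k \<rho>\<^sub>k / 4\<close> equals \<open>4 L\<^sub>D / ((k + 2) (k + 3))\<close>, the loss is \<open>4 L\<^sub>D / (k + 3)\<^sup>2\<close>.\<close>
    have "(1 - \<tau> k)\<^sup>2 = 4 / ((real k + 3) * (real k + 3))"
      by (simp add: \<tau> power2_eq_square field_simps)
    also have "\<dots> \<le> 4 / ((real k + 2) * (real k + 3))"
      by (intro divide_left_mono mult_right_mono) auto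
    also have "\<dots> = \<tau> k * (8 * P k) / 4"
      unfolding \<tau> P_def by (simp add: divide_simps)
    finally have "?LD * (1 - \<tau> k)\<^sup>2 \<le> ?LD * (\<tau> k * (8 * P k) / 4)"
      using LD by (intro mult_left_mono) auto
    then have "?LD * (1 - \<tau> k)\<^sup>2 \<le> \<tau> k * \<rho> k / 4"
      by (simp add: \<rho>_eq algebra_simps)
    from smoothed_gap_step[OF step dom \<tau>01 less_imp_le[OF \<rho>_pos] this]
    have "?gap (Suc k) \<le> ereal (\<tau> k) * ?gap k + ereal ((1 + \<tau> k) * \<eta> k + 2 * \<gamma> k)" .
    also have "\<dots> \<le> ereal (\<tau> k) * ?gap k + ereal ((1 - \<tau> k) * (\<epsilon> / 2))"
    proof -
      \<comment> \<open>The error is below \<open>4 \<eta>\<^sub>k = \<epsilon> / (k + 3)\<close>, and \<open>1 - \<tau>\<^sub>k = 2 / (k + 3)\<close>.\<close>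
      have "\<gamma> k = \<eta> k"
        by (simp add: \<eta> \<gamma>)
      then have "(1 + \<tau> k) * \<eta> k + 2 * \<gamma> k = (3 + \<tau> k) * \<eta> k"
        by (simp add: algebra_simps)
      also have "\<dots> \<le> 4 * \<eta> k"
        using \<tau>01(2)[of k] \<epsilon> by (intro mult_right_mono) (auto simp: \<eta>)
      also have "\<dots> = (1 - \<tau> k) * (\<epsilon> / 2)"
        by (simp add: \<eta> \<tau> field_simps)
      finally show ?thesis by (intro add_left_mono) simp
    qed
    finally show ?thesis .
  qed
  have rate: "?gap K \<le> ereal (P K) * ?gap 0 + ereal (\<epsilon> / 2)"
  proof -
    have "?gap K \<le> ereal (P K) * ?gap 0 + ereal ((1 - P K) * (\<epsilon> / 2))"
      by (rule contraction_with_error[where \<tau> = \<tau>]) (fact gap_step \<tau>01 P0 PS)+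
    also have "\<dots> \<le> ereal (P K) * ?gap 0 + ereal (\<epsilon> / 2)"
      using P_pos[of K] \<epsilon> by (intro add_left_mono) (simp add: algebra_simps)
    finally show ?thesis .
  qed
  define C where "C = (real K + 1) * (real K + 2)"
  have C: "0 < C" "P K = 2 / C"
    by (simp_all add: C_def P_def)
  have "ereal (P K) * ?gap 0 = 2 * ?gap 0 / ereal C"
    using C by (cases "?gap 0") auto
  with rate have smoothed: "?gap K \<le> 2 * ?gap 0 / ereal C + ereal (\<epsilon> / 2)"
    by simp

  have "duality_gap X \<Lambda> f g h \<Phi> (x K) (l K)
      \<le> (ereal (32 * ?LD) * (SUP m\<in>\<Lambda>. \<bar>\<omega> m\<bar>) + 2 * duality_gap X \<Lambda> f g h \<Phi> (x 0) (l 0))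
        / ereal C + ereal (\<epsilon> / 2)"
  proof (cases "SUP m\<in>\<Lambda>. \<bar>\<omega> m\<bar>")
    case (real B)
    let ?g = "\<lambda>k. duality_gap X \<Lambda> f g h \<Phi> (x k) (l k)"
    have B: "\<bar>W m\<bar> \<le> B" if "m \<in> \<Lambda>" for m
    proof -
      have "\<bar>\<omega> m\<bar> \<le> ereal B"
        using SUP_upper[OF that, of "\<lambda>m. \<bar>\<omega> m\<bar>"] unfolding real .
      then show ?thesis by (simp add: \<omega>_finite that)
    qed
    have "?g K \<le> ?gap K + ereal (\<rho> K * B)"
      by (intro duality_gap_le_smoothed_gap dom less_imp_le[OF \<rho>_pos] B)
    also have "\<dots> \<le> (ereal (P K) * ?gap 0 + ereal (\<epsilon> / 2)) + ereal (\<rho> K * B)"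
      by (intro add_right_mono rate)
    also have "\<dots> \<le> (ereal (P K) * (?g 0 + ereal (\<rho> 0 * B)) + ereal (\<epsilon> / 2)) + ereal (\<rho> K * B)"
      using P_pos[of K]
      by (intro add_right_mono ereal_mult_left_mono smoothed_gap_le_duality_gap dom
          less_imp_le[OF \<rho>_pos] B) auto
    also have "\<dots> = (ereal (32 * ?LD) * ereal B + 2 * ?g 0) / ereal C + ereal (\<epsilon> / 2)"
      using C(1) by (cases "?g 0") (auto simp: \<rho>_eq P0 C(2) field_simps)
    finally show ?thesis by (simp add: real)
  next
    case PInf
    then show ?thesis using LD C by simp
  next
    case MInf
    obtain m where m: "m \<in> \<Lambda>" using \<Lambda>(1) by blast
    have "\<bar>\<omega> m\<bar> \<le> -\<infinity>"
      using SUP_upper[OF m, of "\<lambda>m. \<bar>\<omega> m\<bar>"] unfolding MInf .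
    then show ?thesis by (simp add: \<omega>_finite m)
  qed
  with smoothed show ?thesis
    by (simp add: C_def)
qed

end
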